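(* Let $f(\lambda):=\sum_{k=0}^\infty\alpha_k\lambda^k$ be a power series with complex coefficients, convergent on the open disk $D(0,R)$, $R>0$, and let $f_a(\lambda):=\sum_{k=0}^\infty|\alpha_k|\lambda^k$. If $A$ and $B$ are matrices in $M_n(\mathbb{C})$ with $\operatorname{tr}(|A|^p)<R$ and $\operatorname{tr}(|B|^q)<R$, where $p,q>1$ with $\frac1p+\frac1q=1$, then $$\left|\operatorname{tr}\left(f(|AB^*|)\right)\right|\le\operatorname{tr}\left[f_a\left(\frac{|A|^p}{p}+\frac{|B|^q}{q}\right)\right]\le\operatorname{tr}\left[\frac1pf_a(|A|^p)+\frac1qf_a(|B|^q)\right].$$
   Context: $D(0,R)=\{z\in\mathbb{C}:|z|<R\}$ if $R<\infty$ and $D(0,\infty)=\mathbb{C}$. $M_n(\mathbb{C})$ is the algebra of complex $n\times n$ matrices, $|A|:=(A^*A)^{1/2}$, and $f(T):=\sum_{k=0}^\infty\alpha_kT^k$ with $T^0=I_n$; similarly for $f_a$. *)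

theory Defs
  imports "HOL-Analysis.Analysis" "HOL-Library.Complex_Order"
begin

definition adjoint_matrix :: "complex^'n^'m \<Rightarrow> complex^'m^'n" where
  "adjoint_matrix A = transpose (map_matrix cnj A)"

definition unitary_matrix :: "complex^'n^'n \<Rightarrow> bool" where
  "unitary_matrix U \<longleftrightarrow>
     U ** adjoint_matrix U = mat 1 \<and> adjoint_matrix U ** U = mat 1"

definition real_diag :: "('n \<Rightarrow> real) \<Rightarrow> complex^'n^'n" where
  "real_diag d = (\<chi> i j. if i = j then complex_of_real (d i) else 0)"

(* Functional calculus of a Hermitian matrix: h(U diag(d) U* ) = U diag(h(d)) U*.
   For Hermitian H such a decomposition exists, and the result does not depend on
   its choice, because W diag(d) = diag(e) W implies W diag(h(d)) = diag(h(e)) W. *)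
definition spectral_fun :: "(real \<Rightarrow> real) \<Rightarrow> complex^'n^'n \<Rightarrow> complex^'n^'n" where
  "spectral_fun h H = (THE X. \<exists>U d. unitary_matrix U \<and>
     H = U ** real_diag d ** adjoint_matrix U \<and>
     X = U ** real_diag (h \<circ> d) ** adjoint_matrix U)"

(* Real powers of positive semidefinite matrices; note 0 powr r = 0. *)
definition matrix_powr :: "complex^'n^'n \<Rightarrow> real \<Rightarrow> complex^'n^'n" where
  "matrix_powr H r = spectral_fun (\<lambda>x. x powr r) H"

definition matrix_abs :: "complex^'n^'n \<Rightarrow> complex^'n^'n" where
  "matrix_abs A = matrix_powr (adjoint_matrix A ** A) (1 / 2)"

(* The operator ^ on type vec is taken componentwise, hence the separate
   definition for powers with respect to the matrix product. *)
primrec matrix_power :: "complex^'n^'n \<Rightarrow> nat \<Rightarrow> complex^'n^'n" where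
  "matrix_power T 0 = mat 1"
| "matrix_power T (Suc k) = T ** matrix_power T k"

definition matrix_series :: "(nat \<Rightarrow> complex) \<Rightarrow> complex^'n^'n \<Rightarrow> complex^'n^'n" where
  "matrix_series \<alpha> T = (\<Sum>k. map_matrix (\<lambda>x. \<alpha> k * x) (matrix_power T k))"

definition abs_coeffs :: "(nat \<Rightarrow> complex) \<Rightarrow> nat \<Rightarrow> complex" where
  "abs_coeffs \<alpha> k = complex_of_real (cmod (\<alpha> k))"

end

theory Submission
  imports Defs
begin

text \<open>
  Put \<open>X = |A|\<^sup>p/p + |B|\<^sup>q/q\<close>. Ando's matrix Young inequality says that the singular values
  of \<open>A B\<^sup>*\<close> are dominated by the eigenvalues of \<open>X\<close>, hence \<open>tr |A B\<^sup>*|\<^sup>k \<le> tr X\<^sup>k\<close>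
  for every \<open>k\<close>, and the first inequality follows by summing the power series. For unit vectors
  \<open>x = B\<^sup>* z\<close> and \<open>p \<ge> 2\<close>, Jensen's inequality on spectral measures gives
  \<open>\<langle>x, |A|\<^sup>p x\<rangle> \<ge> \<parallel>A x\<parallel>\<^sup>p\<close> and \<open>\<langle>x, |B|\<^sup>q x\<rangle> \<ge> \<parallel>z\<parallel>\<^bsup>-q\<^esup>\<close>, so that
  \<open>\<langle>x, X x\<rangle> \<ge> \<parallel>A x\<parallel> / \<parallel>z\<parallel>\<close> by the scalar Young inequality; a min-max argument
  then yields Ando's theorem without the Loewner-Heinz inequality. For the second inequality,
  an eigenvalue of \<open>X\<close> is a convex combination of Rayleigh quotients of \<open>|A|\<^sup>p\<close> and \<open>|B|\<^sup>q\<close>,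
  and Jensen's inequality for \<open>t \<mapsto> t\<^sup>k\<close> applies.
\<close>

section \<open>Diagonalization of Hermitian matrices\<close>

lemma adjoint_matrix_nth [simp]: "adjoint_matrix A $ i $ j = cnj (A $ j $ i)"
  by (simp add: adjoint_matrix_def transpose_def)

lemma adjoint_matrix_adjoint [simp]: "adjoint_matrix (adjoint_matrix A) = A"
  by (simp add: vec_eq_iff)

lemma adjoint_matrix_mul: "adjoint_matrix (A ** B) = adjoint_matrix B ** adjoint_matrix A"
  by (simp add: vec_eq_iff matrix_matrix_mult_def mult.commute)

lemma adjoint_matrix_add: "adjoint_matrix (A + B) = adjoint_matrix A + adjoint_matrix B"
  by (simp add: vec_eq_iff)

lemma adjoint_matrix_scaleR: "adjoint_matrix (r *\<^sub>R A) = r *\<^sub>R adjoint_matrix A"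
  by (simp add: vec_eq_iff)

lemma adjoint_matrix_real_diag [simp]: "adjoint_matrix (real_diag d) = real_diag d"
  by (auto simp: vec_eq_iff real_diag_def)

lemma real_diag_nth: "real_diag d $ i $ j = (if i = j then complex_of_real (d i) else 0)"
  by (simp add: real_diag_def)

lemma mult_real_diag_nth: "(A ** real_diag d) $ i $ j = A $ i $ j * complex_of_real (d j)"
  by (simp add: matrix_matrix_mult_def real_diag_nth if_distrib if_distribR cong: if_cong)

lemma real_diag_mult_nth: "(real_diag d ** A) $ i $ j = complex_of_real (d i) * A $ i $ j"
  by (simp add: matrix_matrix_mult_def real_diag_nth if_distrib if_distribR cong: if_cong)

lemma real_diag_mult: "real_diag d ** real_diag e = real_diag (\<lambda>i. d i * e i)"
  by (simp add: vec_eq_iff real_diag_mult_nth) (simp add: real_diag_nth)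

lemma real_diag_mult_vec_nth: "(real_diag d *v x) $ i = complex_of_real (d i) * x $ i"
  by (simp add: matrix_vector_mult_def real_diag_nth if_distrib if_distribR cong: if_cong)

lemma unitary_matrix_adjoint: "unitary_matrix U \<Longrightarrow> unitary_matrix (adjoint_matrix U)"
  by (simp add: unitary_matrix_def)

lemma unitary_matrix_mul:
  assumes "unitary_matrix U" "unitary_matrix V"
  shows "unitary_matrix (U ** V)"
proof -
  have "U ** V ** (adjoint_matrix V ** adjoint_matrix U) =
      U ** (V ** adjoint_matrix V) ** adjoint_matrix U"
    "adjoint_matrix V ** adjoint_matrix U ** (U ** V) =
      adjoint_matrix V ** (adjoint_matrix U ** U) ** V"
    by (simp_all only: matrix_mul_assoc)
  with assms show ?thesis
    by (simp add: unitary_matrix_def adjoint_matrix_mul)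
qed

section \<open>The Hermitian inner product and quadratic forms\<close>

text \<open>Conjugate-linear in the first argument. Its real part is the real inner product on
  \<open>complex^'n\<close>, so Cauchy-Schwarz and compactness arguments carry over, while complex
  orthogonality is the vanishing of the full complex value.\<close>

definition cinner :: "complex^'n \<Rightarrow> complex^'n \<Rightarrow> complex" where
  "cinner x y = (\<Sum>i\<in>UNIV. cnj (x $ i) * y $ i)"

lemma cinner_adjoint: "cinner x (A *v y) = cinner (adjoint_matrix A *v x) y"
  unfolding cinner_def matrix_vector_mult_def
  by (simp add: sum_distrib_left sum_distrib_right mult_ac) (rule sum.swap)

lemma matrix_vector_mult_scaleR_right: "A *v (r *\<^sub>R x) = r *\<^sub>R (A *v x)"
  for A :: "complex^'n^'m"
  by (simp add: vec_eq_iff matrix_vector_mult_def scaleR_sum_right)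

lemma inner_eq_Re_cinner: "x \<bullet> y = Re (cinner x y)"
  by (simp add: inner_vec_def cinner_def inner_complex_def)

lemma norm_sq_eq_Re_cinner: "(norm x)\<^sup>2 = Re (cinner x x)" for x :: "complex^'n"
  by (simp add: power2_norm_eq_inner inner_eq_Re_cinner)

lemma norm_sq_eq_sum: "(norm x)\<^sup>2 = (\<Sum>i\<in>UNIV. (cmod (x $ i))\<^sup>2)" for x :: "complex^'n"
  by (simp add: norm_vec_def L2_set_def sum_nonneg)

lemma cinner_self: "cinner x x = complex_of_real ((norm x)\<^sup>2)"
  unfolding norm_sq_eq_sum cinner_def
  by (simp add: complex_norm_square[symmetric] mult.commute)

lemma cinner_commute: "cinner y x = cnj (cinner x y)"
  by (simp add: cinner_def mult.commute)

lemma cinner_add_right: "cinner x (y + z) = cinner x y + cinner x z"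
  by (simp add: cinner_def distrib_left sum.distrib)

lemma cinner_diff_right: "cinner x (y - z) = cinner x y - cinner x z"
  by (simp add: cinner_def right_diff_distrib sum_subtractf)

lemma cinner_scaleR_right: "cinner x (r *\<^sub>R y) = complex_of_real r * cinner x y"
  unfolding cinner_def sum_distrib_left vector_scaleR_component scaleR_conv_of_real[where 'a=complex]
  by (simp add: mult_ac)

lemma Re_cinner_le_norm: "Re (cinner x y) \<le> norm x * norm y"
  using norm_cauchy_schwarz[of x y] by (simp add: inner_eq_Re_cinner)

lemma norm_adjoint_unitary:
  assumes "unitary_matrix U"
  shows "norm (adjoint_matrix U *v x) = norm x"
proof -
  have "cinner (adjoint_matrix U *v x) (adjoint_matrix U *v x) = cinner (U *v (adjoint_matrix U *v x)) x"
    by (metis cinner_adjoint cinner_commute adjoint_matrix_adjoint)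
  also have "\<dots> = cinner x x"
    using assms by (simp add: matrix_vector_mul_assoc unitary_matrix_def)
  finally have "(norm (adjoint_matrix U *v x))\<^sup>2 = (norm x)\<^sup>2"
    by (simp only: cinner_self of_real_eq_iff)
  then show ?thesis
    by simp
qed

lemma cinner_diagonalized:
  "cinner x ((U ** real_diag d ** adjoint_matrix U) *v x) =
    complex_of_real (\<Sum>i\<in>UNIV. d i * (cmod ((adjoint_matrix U *v x) $ i))\<^sup>2)"
proof -
  have "cinner x ((U ** real_diag d ** adjoint_matrix U) *v x) =
      cinner (adjoint_matrix U *v x) (real_diag d *v (adjoint_matrix U *v x))"
    by (simp add: matrix_vector_mul_assoc[symmetric] cinner_adjoint)
  also have "\<dots> = complex_of_real (\<Sum>i\<in>UNIV. d i * (cmod ((adjoint_matrix U *v x) $ i))\<^sup>2)"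
    by (simp only: cinner_def real_diag_mult_vec_nth)
      (simp add: complex_norm_square mult_ac del: of_real_power)
  finally show ?thesis .
qed

section \<open>The spectral theorem by maximizing Rayleigh quotients\<close>

text \<open>Complex orthogonality to \<open>u\<close> amounts to real orthogonality to both
  \<open>u\<close> and its multiple by the imaginary unit. This doubles the number of conditions,
  but the real dimension is \<open>2 * CARD('n)\<close>, so a dimension count still leaves a nonzero
  vector.\<close>

lemma exists_cinner_orthogonal:
  fixes W :: "(complex^'n) set"
  assumes "finite W" "card W < CARD('n)"
  obtains x where "x \<noteq> 0" "\<And>u. u \<in> W \<Longrightarrow> cinner u x = 0"
proof -
  let ?S = "W \<union> (\<lambda>u. \<i> *s u) ` W"
  have "card ?S \<le> card W + card W"
    by (meson card_Un_le card_image_le assms(1) add_left_mono le_trans)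
  then have "dim ?S < DIM(complex^'n)"
    using assms dim_le_card'[of ?S] by simp
  then obtain x where x: "x \<noteq> 0" "\<And>y. y \<in> span ?S \<Longrightarrow> orthogonal x y"
    by (rule orthogonal_to_subspace_exists) blast
  have "cinner u x = 0" if "u \<in> W" for u
  proof (rule complex_eqI)
    have "u \<bullet> x = 0" "(\<i> *s u) \<bullet> x = 0"
      using x(2)[of u] x(2)[of "\<i> *s u"] that by (auto simp: span_base orthogonal_def inner_commute)
    moreover have "cinner (\<i> *s u) x = - \<i> * cinner u x"
      by (simp add: cinner_def sum_distrib_left mult_ac)
    ultimately show "Re (cinner u x) = Re 0" "Im (cinner u x) = Im 0"
      by (simp_all add: inner_eq_Re_cinner)
  qed
  with x(1) that show thesis by blast
qed

text \<open>First-order optimality test: if \<open>a\<close> were positive, then at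
  \<open>t = a / (\<bar>c\<bar> + 1)\<close> the quadratic term could cancel at most half of the
  linear one.\<close>

lemma linear_coeff_nonpos:
  fixes a c :: real
  assumes "\<And>t. 2 * t * a + t\<^sup>2 * c \<le> 0"
  shows "a \<le> 0"
proof (rule ccontr)
  assume a: "\<not> a \<le> 0"
  define t where "t = a / (\<bar>c\<bar> + 1)"
  have t: "t > 0" using a by (simp add: t_def)
  have "t * \<bar>c\<bar> \<le> a" using a by (simp add: t_def field_simps)
  then have "t * (t * \<bar>c\<bar>) \<le> t * a" using t by (intro mult_left_mono) auto
  moreover have "- (t * (t * \<bar>c\<bar>)) \<le> t\<^sup>2 * c"
    using t by (simp add: power2_eq_square abs_if)
  ultimately have "t * a \<le> 0" using assms[of t] by linarith
  then show False using t a by (simp add: mult_le_0_iff)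
qed

text \<open>The orthogonal complement \<open>S\<close> of the given eigenvectors is invariant under
  \<open>H\<close>. A maximizer of the quadratic form on the unit sphere of \<open>S\<close> is an
  eigenvector, because the residual \<open>w = H x - \<mu> x\<close> is an admissible direction of
  variation and would otherwise increase the Rayleigh quotient.\<close>

lemma hermitian_eigenvector_orthogonal:
  fixes H :: "complex^'n^'n"
  assumes herm: "adjoint_matrix H = H"
    and W: "finite W" "card W < CARD('n)"
    and eig: "\<And>u. u \<in> W \<Longrightarrow> \<exists>r::real. H *v u = r *\<^sub>R u"
  obtains x \<mu> where "norm x = 1" "H *v x = \<mu> *\<^sub>R x" "\<And>u. u \<in> W \<Longrightarrow> cinner u x = 0"
proof -
  define S where "S = {x. \<forall>u\<in>W. cinner u x = 0}"
  have HS: "H *v x \<in> S" if "x \<in> S" for x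
  proof -
    have "cinner u (H *v x) = 0" if "u \<in> W" for u
    proof -
      obtain r :: real where "H *v u = r *\<^sub>R u" using eig \<open>u \<in> W\<close> by blast
      then have "cinner u (H *v x) = cnj (complex_of_real r * cinner x u)"
        by (metis cinner_adjoint herm cinner_commute cinner_scaleR_right)
      also have "\<dots> = 0"
        using \<open>x \<in> S\<close> \<open>u \<in> W\<close> by (simp add: S_def cinner_commute[of x u])
      finally show ?thesis .
    qed
    then show ?thesis by (simp add: S_def)
  qed
  have lin: "x + r *\<^sub>R y \<in> S" "r *\<^sub>R x \<in> S" "y - r *\<^sub>R x \<in> S" if "x \<in> S" "y \<in> S" for x y and r :: real
    using that by (simp_all add: S_def cinner_add_right cinner_scaleR_right cinner_diff_right)
  obtain z where "z \<noteq> 0" "\<And>u. u \<in> W \<Longrightarrow> cinner u z = 0"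
    by (rule exists_cinner_orthogonal[OF W]) blast
  then have z: "z \<noteq> 0" "z \<in> S" by (auto simp: S_def)
  have cont: "continuous_on UNIV (cinner u)" for u :: "complex^'n"
    unfolding cinner_def by (intro continuous_intros)
  have "S = (\<Inter>u\<in>W. {x. cinner u x = 0})" by (auto simp: S_def)
  then have "closed S"
    by (auto intro!: closed_INT closed_Collect_eq cont)
  then have "compact (sphere 0 1 \<inter> S)"
    by (simp add: compact_Int_closed)
  moreover have "z /\<^sub>R norm z \<in> sphere 0 1 \<inter> S"
    using z lin by auto
  moreover have "continuous_on (sphere 0 1 \<inter> S) (\<lambda>x. x \<bullet> (H *v x))"
    unfolding matrix_vector_mult_def
    by (intro continuous_intros)
  ultimately have "\<exists>x\<in>sphere 0 1 \<inter> S. \<forall>y\<in>sphere 0 1 \<inter> S. y \<bullet> (H *v y) \<le> x \<bullet> (H *v x)"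
    by (intro continuous_attains_sup) blast+
  then obtain x where x: "x \<in> sphere 0 1 \<inter> S"
    and mx: "\<And>y. y \<in> sphere 0 1 \<inter> S \<Longrightarrow> y \<bullet> (H *v y) \<le> x \<bullet> (H *v x)"
    by blast
  define \<mu> where "\<mu> = x \<bullet> (H *v x)"
  have xS: "x \<in> S" and nx: "norm x = 1" using x by auto
  have le: "y \<bullet> (H *v y) \<le> \<mu> * (y \<bullet> y)" if "y \<in> S" for y
  proof (cases "y = 0")
    case False
    have "(y /\<^sub>R norm y) \<bullet> (H *v (y /\<^sub>R norm y)) \<le> \<mu>"
      unfolding \<mu>_def using mx[of "y /\<^sub>R norm y"] that False lin by auto
    then have "inverse (norm y) * (inverse (norm y) * (y \<bullet> (H *v y))) \<le> \<mu>"
      by (simp add: matrix_vector_mult_scaleR_right)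
    then show ?thesis
      using False by (simp add: field_simps dot_square_norm power2_eq_square)
  qed simp
  define w where "w = H *v x - \<mu> *\<^sub>R x"
  have wS: "w \<in> S" unfolding w_def using lin HS xS by blast
  have symm: "x \<bullet> (H *v y) = (H *v x) \<bullet> y" for x y
    by (simp add: inner_eq_Re_cinner cinner_adjoint herm)
  define c where "c = w \<bullet> (H *v w) - \<mu> * (w \<bullet> w)"
  \<comment> \<open>Expanding the Rayleigh bound at \<open>x + t w\<close>, the first-order
    coefficient is exactly \<open>w \<bullet> w\<close>, so the optimality test forces
    \<open>w = 0\<close>.\<close>
  have quad: "2 * t * (w \<bullet> w) + t\<^sup>2 * c \<le> 0" for t :: real
  proof -
    have "x + t *\<^sub>R w \<in> S" using lin xS wS by blast
    from le[OF this] have *: "\<mu> + 2 * t * (w \<bullet> (H *v x)) + t\<^sup>2 * (w \<bullet> (H *v w))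
        \<le> \<mu> * (1 + 2 * t * (w \<bullet> x) + t\<^sup>2 * (w \<bullet> w))"
      using nx by (simp add: \<mu>_def matrix_vector_right_distrib matrix_vector_mult_scaleR_right symm[of x w]
          inner_add_left inner_add_right inner_commute[of x w] inner_commute[of "H *v x" w] norm_eq_1 power2_eq_square algebra_simps)
    have "w \<bullet> (H *v x) = w \<bullet> w + \<mu> * (w \<bullet> x)"
      by (simp add: w_def inner_diff_right)
    from *[unfolded this] show ?thesis by (simp add: c_def algebra_simps)
  qed
  have "w \<bullet> w \<le> 0"
    by (rule linear_coeff_nonpos) (rule quad)
  then have "w = 0"
    by (metis inner_gt_zero_iff not_le)
  then have "H *v x = \<mu> *\<^sub>R x" by (simp add: w_def)
  with nx xS that show thesis by (auto simp: S_def)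
qed

theorem hermitian_diagonalization:
  fixes H :: "complex^'n^'n"
  assumes herm: "adjoint_matrix H = H"
  obtains U d where "unitary_matrix U" "H = U ** real_diag d ** adjoint_matrix U"
proof -
  \<comment> \<open>An orthonormal family of eigenvectors is built by induction on its index set, so
    that it ends up indexed by the matrix index type itself.\<close>
  have "\<exists>v d. \<forall>i\<in>I. H *v v i = (d i :: real) *\<^sub>R v i \<and>
      (\<forall>j\<in>I. cinner (v i) (v j) = (if i = j then 1 else 0))" for I :: "'n set"
    using finite[of I]
  proof (induction I)
    case empty
    then show ?case by simp
  next
    case (insert k I)
    then obtain v d where vd: "\<And>i. i \<in> I \<Longrightarrow> H *v v i = (d i :: real) *\<^sub>R v i"
      "\<And>i j. i \<in> I \<Longrightarrow> j \<in> I \<Longrightarrow> cinner (v i) (v j) = (if i = j then 1 else 0)"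
      by metis
    have "card (v ` I) \<le> card I" by (rule card_image_le) simp
    also have "card I < CARD('n)"
      using insert.hyps by (intro psubset_card_mono) auto
    finally have "card (v ` I) < CARD('n)" .
    moreover have "\<exists>r::real. H *v u = r *\<^sub>R u" if "u \<in> v ` I" for u
      using that vd(1) by blast
    ultimately obtain x \<mu> where x: "norm x = 1" "H *v x = \<mu> *\<^sub>R x"
      "\<And>u. u \<in> v ` I \<Longrightarrow> cinner u x = 0"
      using hermitian_eigenvector_orthogonal[OF herm finite_imageI[OF finite]] by metis
    have x': "cinner x (v i) = 0" "cinner (v i) x = 0" if "i \<in> I" for i
      using x(3)[of "v i"] that by (auto simp: cinner_commute[of x])
    have "cinner x x = 1" using x(1) by (simp add: cinner_self)
    then show ?case
      using insert.hyps vd x x'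
      by (intro exI[of _ "v(k := x)"] exI[of _ "d(k := \<mu>)"]) auto
  qed
  from this[of UNIV] obtain v :: "'n \<Rightarrow> complex^'n" and d where
    vd: "\<And>i. H *v v i = (d i :: real) *\<^sub>R v i"
      "\<And>i j. cinner (v i) (v j) = (if i = j then 1 else 0)"
    by auto
  define U :: "complex^'n^'n" where "U = (\<chi> i j. v j $ i)"
  have 1: "adjoint_matrix U ** U = mat 1"
    using vd(2) by (simp add: vec_eq_iff matrix_matrix_mult_def mat_def U_def cinner_def)
  then have U: "unitary_matrix U"
    by (simp add: unitary_matrix_def matrix_left_right_inverse)
  have "H ** U = U ** real_diag d"
    using vd(1) by (simp add: vec_eq_iff mult_real_diag_nth)
       (simp add: matrix_matrix_mult_def matrix_vector_mult_def U_def scaleR_conv_of_real mult_ac)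
  then have "H = U ** real_diag d ** adjoint_matrix U"
    by (metis U unitary_matrix_def matrix_mul_assoc matrix_mul_rid)
  with U that show thesis by blast
qed

section \<open>Functional calculus, traces and power series in a diagonalizing basis\<close>

text \<open>Any two diagonalizations are linked by \<open>W = V\<^sup>* U\<close>, which intertwines
  the diagonal matrices. Entrywise this says that \<open>W $ i $ j\<close> vanishes unless
  \<open>d j = e i\<close>; hence \<open>W\<close> still intertwines them after \<open>h\<close> is
  applied, and the definite description is well defined.\<close>

lemma spectral_fun_diagonalized:
  assumes U: "unitary_matrix U" and H: "H = U ** real_diag d ** adjoint_matrix U"
  shows "spectral_fun h H = U ** real_diag (h \<circ> d) ** adjoint_matrix U"
  unfolding spectral_fun_def
proof (rule the_equality)
  show "\<exists>V e. unitary_matrix V \<and> H = V ** real_diag e ** adjoint_matrix V \<and>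
      U ** real_diag (h \<circ> d) ** adjoint_matrix U = V ** real_diag (h \<circ> e) ** adjoint_matrix V"
    using assms by blast
next
  fix X
  assume "\<exists>V e. unitary_matrix V \<and> H = V ** real_diag e ** adjoint_matrix V \<and>
      X = V ** real_diag (h \<circ> e) ** adjoint_matrix V"
  then obtain V e where V: "unitary_matrix V" "H = V ** real_diag e ** adjoint_matrix V"
    and X: "X = V ** real_diag (h \<circ> e) ** adjoint_matrix V" by blast
  define W where "W = adjoint_matrix V ** U"
  have UU: "U ** adjoint_matrix U = mat 1" "adjoint_matrix U ** U = mat 1"
    and VV: "V ** adjoint_matrix V = mat 1" "adjoint_matrix V ** V = mat 1"
    using U V by (auto simp: unitary_matrix_def)
  have "W ** real_diag d = adjoint_matrix V ** H ** U"
    unfolding W_def H by (metis UU(2) matrix_mul_assoc matrix_mul_rid)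
  also have "\<dots> = real_diag e ** W"
    unfolding W_def V(2) by (metis VV(2) matrix_mul_assoc matrix_mul_lid)
  finally have "W $ i $ j * complex_of_real (d j) = complex_of_real (e i) * W $ i $ j" for i j
    by (metis mult_real_diag_nth real_diag_mult_nth)
  then have "W $ i $ j = 0 \<or> d j = e i" for i j
    by (metis mult.commute mult_cancel_left of_real_eq_iff)
  then have "W ** real_diag (h \<circ> d) = real_diag (h \<circ> e) ** W"
    by (simp add: vec_eq_iff mult_real_diag_nth real_diag_mult_nth) (metis mult.commute)
  then have "V ** (W ** real_diag (h \<circ> d)) ** adjoint_matrix U =
      V ** (real_diag (h \<circ> e) ** W) ** adjoint_matrix U" by simp
  then show "X = U ** real_diag (h \<circ> d) ** adjoint_matrix U"
    unfolding X W_def by (metis UU(1) VV(1) matrix_mul_assoc matrix_mul_lid matrix_mul_rid)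
qed

lemma trace_diagonalized:
  assumes "unitary_matrix U"
  shows "trace (U ** real_diag d ** adjoint_matrix U) = complex_of_real (sum d UNIV)"
proof -
  have "trace (U ** real_diag d ** adjoint_matrix U) = trace (real_diag d)"
    using assms by (metis trace_mul_sym matrix_mul_assoc matrix_mul_lid unitary_matrix_def)
  then show ?thesis by (simp add: trace_def real_diag_nth)
qed

lemma matrix_power_diagonalized:
  assumes "unitary_matrix U"
  shows "matrix_power (U ** real_diag d ** adjoint_matrix U) k =
    U ** real_diag (\<lambda>i. d i ^ k) ** adjoint_matrix U"
proof (induction k)
  case 0
  have "real_diag (\<lambda>i. 1) = (mat 1 :: complex^'a^'a)"
    by (simp add: vec_eq_iff real_diag_nth mat_def)
  then show ?case using assms by (simp add: unitary_matrix_def)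
next
  case (Suc k)
  have "U ** real_diag d ** adjoint_matrix U ** (U ** real_diag (\<lambda>i. d i ^ k) ** adjoint_matrix U)
      = U ** (real_diag d ** real_diag (\<lambda>i. d i ^ k)) ** adjoint_matrix U"
    using assms unfolding unitary_matrix_def by (metis matrix_mul_assoc matrix_mul_rid)
  then show ?case by (simp add: Suc real_diag_mult)
qed

text \<open>Each matrix entry of the series is a finite combination of the scalar series at the
  eigenvalues, so convergence there gives entrywise convergence, and the trace may be taken term by
  term.\<close>

lemma matrix_series_diagonalized:
  assumes U: "unitary_matrix U"
    and sm: "\<And>i. summable (\<lambda>k. \<alpha> k * complex_of_real (d i) ^ k)"
  shows "(\<lambda>k. \<alpha> k * complex_of_real (\<Sum>i\<in>UNIV. d i ^ k)) sums
    trace (matrix_series \<alpha> (U ** real_diag d ** adjoint_matrix U))"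
proof -
  let ?T = "\<lambda>k. map_matrix (\<lambda>x. \<alpha> k * x) (matrix_power (U ** real_diag d ** adjoint_matrix U) k)"
  have *: "matrix_power (U ** real_diag d ** adjoint_matrix U) k $ i $ j =
      (\<Sum>l\<in>UNIV. U $ i $ l * complex_of_real (d l) ^ k * cnj (U $ j $ l))" for k i j
    unfolding matrix_power_diagonalized[OF U]
    by (subst matrix_matrix_mult_def) (simp add: mult_real_diag_nth)
  have "?T sums (\<chi> i j. \<Sum>k. ?T k $ i $ j)"
  proof -
    have "(\<lambda>k. ?T k $ i $ j) sums (\<Sum>k. ?T k $ i $ j)" for i j
    proof (rule summable_sums)
      have "summable (\<lambda>k. \<Sum>l\<in>UNIV. U $ i $ l * cnj (U $ j $ l) * (\<alpha> k * complex_of_real (d l) ^ k))"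
        by (intro summable_sum summable_mult sm)
      then show "summable (\<lambda>k. ?T k $ i $ j)"
        by (simp add: * sum_distrib_left mult_ac)
    qed
    then show ?thesis
      unfolding sums_def by (intro vec_tendstoI) simp
  qed
  then have "?T sums matrix_series \<alpha> (U ** real_diag d ** adjoint_matrix U)"
    unfolding matrix_series_def by (rule summable_sums[OF sums_summable])
  then have "(\<lambda>k. ?T k $ i $ i) sums (matrix_series \<alpha> (U ** real_diag d ** adjoint_matrix U) $ i $ i)" for i
    by (intro bounded_linear.sums[OF bounded_linear_vec_nth])
  then have "(\<lambda>k. \<Sum>i\<in>UNIV. ?T k $ i $ i) sums trace (matrix_series \<alpha> (U ** real_diag d ** adjoint_matrix U))"
    unfolding trace_def by (intro sums_sum) auto
  moreover have "(\<Sum>i\<in>UNIV. ?T k $ i $ i) = \<alpha> k * complex_of_real (\<Sum>i\<in>UNIV. d i ^ k)" for k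
    unfolding trace_diagonalized[OF U, symmetric] matrix_power_diagonalized[OF U, symmetric]
    by (simp add: trace_def sum_distrib_left)
  ultimately show ?thesis by simp
qed


section \<open>Scalar inequalities\<close>

text \<open>The second derivative carries the factor \<open>r * (r - 1)\<close>, nonnegative for
  \<open>r \<ge> 1\<close> and for \<open>r \<le> 0\<close>. The endpoint \<open>t = 0\<close>,
  where the derivative argument does not apply, is checked directly.\<close>

lemma powr_above_tangent:
  fixes c t r :: real
  assumes "0 < c" "0 \<le> t" "1 \<le> r \<or> (r \<le> 0 \<and> 0 < t)"
  shows "c powr r + r * c powr (r - 1) * (t - c) \<le> t powr r"
proof (cases "t = 0")
  case True
  have "c powr r = c powr (r - 1) * c"
    using assms(1) by (simp add: powr_diff)
  moreover have "(1 - r) * c powr r \<le> 0"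
    using assms True by (intro mult_nonpos_nonneg) auto
  ultimately show ?thesis
    using True by (simp add: algebra_simps)
next
  case False
  have "r * c powr (r - 1) * (t - c) \<le> t powr r - c powr r"
  proof (rule f''_imp_f'[where C = "{0<..}" and f'' = "\<lambda>x. r * ((r - 1) * x powr (r - 1 - 1))"])
    have "0 \<le> r * (r - 1)"
      using assms(3) by (auto simp: zero_le_mult_iff)
    then show "0 \<le> r * ((r - 1) * x powr (r - 1 - 1))" for x
      by (simp add: mult.assoc[symmetric])
    show "((\<lambda>x. x powr r) has_real_derivative r * x powr (r - 1)) (at x)" if "x \<in> {0<..}" for x
      using that by (auto intro!: derivative_eq_intros)
    show "((\<lambda>x. r * x powr (r - 1)) has_real_derivative r * ((r - 1) * x powr (r - 1 - 1))) (at x)"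
      if "x \<in> {0<..}" for x
      using that by (auto intro!: derivative_eq_intros)
  qed (use assms False in auto)
  then show ?thesis by simp
qed

text \<open>Jensen for \<open>t \<mapsto> t powr r\<close>, admitting nodes \<open>t i = 0\<close>: for negative \<open>r\<close>
  the junk value \<open>0 powr r = 0\<close> is harmless only when it has weight zero.\<close>
lemma powr_weighted_mean:
  fixes w t :: "'i \<Rightarrow> real"
  assumes w: "\<And>i. i \<in> I \<Longrightarrow> 0 \<le> w i" "sum w I = 1"
    and t: "\<And>i. i \<in> I \<Longrightarrow> 0 \<le> t i"
    and pos: "0 < (\<Sum>i\<in>I. w i * t i)"
    and r: "1 \<le> r \<or> (r \<le> 0 \<and> (\<forall>i\<in>I. w i \<noteq> 0 \<longrightarrow> t i \<noteq> 0))"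
  shows "(\<Sum>i\<in>I. w i * t i) powr r \<le> (\<Sum>i\<in>I. w i * t i powr r)"
proof -
  define m where "m = (\<Sum>i\<in>I. w i * t i)"
  \<comment> \<open>The tangent is taken at the mean \<open>m\<close>, so its linear part cancels on
    summation. Nodes of weight zero are split off because the tangent bound may fail at
    them.\<close>
  have "w i * (m powr r + r * m powr (r - 1) * (t i - m)) \<le> w i * t i powr r" if "i \<in> I" for i
  proof (cases "w i = 0")
    case False
    then have "m powr r + r * m powr (r - 1) * (t i - m) \<le> t i powr r"
      using pos t[OF that] r that by (intro powr_above_tangent) (auto simp: m_def order_less_le)
    then show ?thesis
      using w(1)[OF that] by (rule mult_left_mono)
  qed simp
  then have "(\<Sum>i\<in>I. w i * (m powr r + r * m powr (r - 1) * (t i - m))) \<le> (\<Sum>i\<in>I. w i * t i powr r)"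
    by (rule sum_mono)
  moreover have "(\<Sum>i\<in>I. w i * (m powr r + r * m powr (r - 1) * (t i - m))) =
      sum w I * (m powr r - r * m powr (r - 1) * m) + r * m powr (r - 1) * (\<Sum>i\<in>I. w i * t i)"
    by (simp add: sum_distrib_left sum_distrib_right sum.distrib sum_subtractf algebra_simps)
  ultimately show ?thesis
    by (simp add: w(2) m_def)
qed

lemma power_weighted_mean:
  fixes w t :: "'i \<Rightarrow> real"
  assumes "finite I" "\<And>i. i \<in> I \<Longrightarrow> 0 \<le> w i" "sum w I = 1" "\<And>i. i \<in> I \<Longrightarrow> 0 \<le> t i"
  shows "(\<Sum>i\<in>I. w i * t i) ^ k \<le> (\<Sum>i\<in>I. w i * t i ^ k)"
proof -
  have "I \<noteq> {}" using assms(3) by auto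
  have "convex_on {0..} (\<lambda>x::real. x ^ k)"
    using convex_power_even[of k] convex_power_odd[of k] convex_on_subset
    by (cases "even k") auto
  from convex_on_sum[OF assms(1) \<open>I \<noteq> {}\<close> this assms(3,2), of t] assms(4)
  show ?thesis by simp
qed

text \<open>Superlevel counts express domination of the decreasing rearrangements without sorting.
  The counting condition makes the maximum of \<open>g\<close> dominate that of \<open>f\<close>,
  and it survives the removal of one maximizer from each side, so induction applies.\<close>

lemma sum_power_le_of_card_superlevel:
  fixes f :: "'i \<Rightarrow> real" and g :: "'j \<Rightarrow> real"
  assumes "finite I" "finite J" "card I = card J"
    and "\<And>i. i \<in> I \<Longrightarrow> 0 \<le> f i"
    and "\<And>t. card {i\<in>I. t \<le> f i} \<le> card {j\<in>J. t \<le> g j}"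
  shows "(\<Sum>i\<in>I. f i ^ k) \<le> (\<Sum>j\<in>J. g j ^ k)"
  using assms
proof (induction "card I" arbitrary: I J)
  case 0
  then show ?case by simp
next
  case (Suc n)
  then have ne: "I \<noteq> {}" "J \<noteq> {}" by auto
  obtain a where a: "a \<in> I" "\<And>i. i \<in> I \<Longrightarrow> f i \<le> f a"
    using Max_in[of "f ` I"] Max_ge[of "f ` I"] Suc.prems(1) ne by fastforce
  obtain b where b: "b \<in> J" "\<And>j. j \<in> J \<Longrightarrow> g j \<le> g b"
    using Max_in[of "g ` J"] Max_ge[of "g ` J"] Suc.prems(2) ne by fastforce
  have ab: "f a \<le> g b"
  proof (rule ccontr)
    assume "\<not> f a \<le> g b"
    then have "{j\<in>J. f a \<le> g j} = {}" using b(2) by force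
    then have "card {i\<in>I. f a \<le> f i} = 0"
      using Suc.prems(5)[of "f a"] by (metis card.empty le_zero_eq)
    then show False
      using a(1) Suc.prems(1) by auto
  qed
  have "(\<Sum>i\<in>I - {a}. f i ^ k) \<le> (\<Sum>j\<in>J - {b}. g j ^ k)"
  proof (rule Suc.hyps(1))
    show "card {i \<in> I - {a}. t \<le> f i} \<le> card {j \<in> J - {b}. t \<le> g j}" for t
    proof (cases "t \<le> f a")
      case True
      have "{i \<in> I - {a}. t \<le> f i} = {i \<in> I. t \<le> f i} - {a}"
        "{j \<in> J - {b}. t \<le> g j} = {j \<in> J. t \<le> g j} - {b}" by auto
      then show ?thesis
        using True ab a(1) b(1) Suc.prems(1,2) Suc.prems(5)[of t] by simp
    next
      case False
      then have "{i \<in> I - {a}. t \<le> f i} = {}" using a(2) by force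
      then show ?thesis by (metis card.empty le0)
    qed
  qed (use Suc.hyps(2) Suc.prems a(1) b(1) in auto)
  moreover have "f a ^ k \<le> g b ^ k"
    using ab Suc.prems(4) a(1) by (simp add: power_mono)
  ultimately show ?case
    using Suc.prems(1,2) a(1) b(1) by (simp add: sum.remove)
qed


section \<open>Ando's matrix Young inequality\<close>

text \<open>The rows of \<open>M\<close> are orthogonal with squared norms \<open>d i\<close>. The
  last claim is Bessel's inequality for the normalized rows, with zero rows contributing
  nothing.\<close>

lemma diagonal_gram:
  fixes M :: "complex^'n^'n"
  assumes gram: "M ** adjoint_matrix M = real_diag d"
  shows "0 \<le> d i"
    and "d i = 0 \<Longrightarrow> (M *v z) $ i = 0"
    and "(\<Sum>i\<in>UNIV. (cmod ((M *v z) $ i))\<^sup>2 * inverse (d i)) \<le> (norm z)\<^sup>2"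
proof -
  have d: "d i = (norm (M $ i))\<^sup>2" for i
  proof -
    have "complex_of_real (d i) = (M ** adjoint_matrix M) $ i $ i"
      by (simp add: gram real_diag_nth)
    also have "\<dots> = complex_of_real ((norm (M $ i))\<^sup>2)"
      unfolding norm_sq_eq_sum by (simp add: matrix_matrix_mult_def complex_norm_square del: of_real_power)
    finally show ?thesis by (simp only: of_real_eq_iff)
  qed
  show "0 \<le> d i" by (simp add: d)
  show "(M *v z) $ i = 0" if "d i = 0"
    using that by (simp add: d matrix_vector_mult_def)
  define m where "m = (\<Sum>i\<in>UNIV. (cmod ((M *v z) $ i))\<^sup>2 * inverse (d i))"
  have "0 \<le> m" unfolding m_def by (intro sum_nonneg) (simp add: d)
  \<comment> \<open>Chosen so that pairing it with \<open>M *v z\<close> and taking the squared norm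
    of its image under the adjoint both give \<open>m\<close>; Cauchy-Schwarz then bounds
    \<open>m\<close> by the squared norm of \<open>z\<close>.\<close>
  define \<eta> where "\<eta> = (\<chi> i. complex_of_real (inverse (d i)) * (M *v z) $ i)"
  have "cinner \<eta> (M *v z) = complex_of_real m"
    by (simp add: cinner_def \<eta>_def m_def complex_norm_square mult_ac del: of_real_power)
  then have "m \<le> norm (adjoint_matrix M *v \<eta>) * norm z"
    using Re_cinner_le_norm[of "adjoint_matrix M *v \<eta>" z] by (simp add: cinner_adjoint)
  moreover have "(norm (adjoint_matrix M *v \<eta>))\<^sup>2 = m"
  proof -
    have "cinner (adjoint_matrix M *v \<eta>) (adjoint_matrix M *v \<eta>) = cinner \<eta> (real_diag d *v \<eta>)"
      by (simp add: gram[symmetric] matrix_vector_mul_assoc[symmetric] cinner_adjoint)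
    also have "\<dots> = complex_of_real m"
      unfolding cinner_def m_def of_real_sum real_diag_mult_vec_nth
    proof (rule sum.cong)
      fix i
      \<comment> \<open>The convention \<open>inverse 0 = 0\<close> makes
        \<open>inverse (d i)\<close> a pseudo-inverse, so zero rows need no separate sum.\<close>
      have "d i * inverse (d i) * inverse (d i) = inverse (d i)" by (cases "d i = 0") simp_all
      then have "complex_of_real (d i) * complex_of_real (inverse (d i)) * complex_of_real (inverse (d i)) =
          complex_of_real (inverse (d i))" by (metis of_real_mult)
      then show "cnj (\<eta> $ i) * (complex_of_real (d i) * \<eta> $ i) =
          complex_of_real ((cmod ((M *v z) $ i))\<^sup>2 * inverse (d i))"
        unfolding of_real_mult complex_norm_square
        by (cases "d i = 0") (simp_all add: \<eta>_def mult_ac)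
    qed simp
    finally show ?thesis by (simp add: norm_sq_eq_Re_cinner)
  qed
  ultimately have "m\<^sup>2 \<le> m * (norm z)\<^sup>2"
    using \<open>0 \<le> m\<close> by (metis power_mono power_mult_distrib)
  then show "(\<Sum>i\<in>UNIV. (cmod ((M *v z) $ i))\<^sup>2 * inverse (d i)) \<le> (norm z)\<^sup>2"
    using \<open>0 \<le> m\<close> unfolding m_def[symmetric]
    by (cases "m = 0") (auto simp: power2_eq_square)
qed

lemma gram_of_diagonalization:
  fixes A :: "complex^'n^'n"
  assumes U: "unitary_matrix U" and H: "adjoint_matrix A ** A = U ** real_diag a ** adjoint_matrix U"
  shows "(adjoint_matrix U ** adjoint_matrix A) ** adjoint_matrix (adjoint_matrix U ** adjoint_matrix A) = real_diag a"
proof -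
  have "(adjoint_matrix U ** adjoint_matrix A) ** adjoint_matrix (adjoint_matrix U ** adjoint_matrix A) =
     adjoint_matrix U ** (adjoint_matrix A ** A) ** U"
    by (simp add: adjoint_matrix_mul matrix_mul_assoc)
  also have "\<dots> = (adjoint_matrix U ** U) ** real_diag a ** (adjoint_matrix U ** U)"
    unfolding H by (simp only: matrix_mul_assoc)
  finally show ?thesis using U by (simp add: unitary_matrix_def)
qed

text \<open>One unitary serves the Gram matrix, the absolute value and all its powers. The
  \<open>a i\<close> are squared singular values, which explains the exponent
  \<open>p / 2\<close>.\<close>

lemma matrix_abs_diagonalization:
  fixes A :: "complex^'n^'n"
  obtains U a where "unitary_matrix U" "\<And>i. 0 \<le> a i"
    "adjoint_matrix A ** A = U ** real_diag a ** adjoint_matrix U"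
    "matrix_abs A = U ** real_diag (\<lambda>i. sqrt (a i)) ** adjoint_matrix U"
    "\<And>p. matrix_powr (matrix_abs A) p = U ** real_diag (\<lambda>i. a i powr (p / 2)) ** adjoint_matrix U"
proof -
  have "adjoint_matrix (adjoint_matrix A ** A) = adjoint_matrix A ** A"
    by (simp add: adjoint_matrix_mul)
  then obtain U a where U: "unitary_matrix U"
    and H: "adjoint_matrix A ** A = U ** real_diag a ** adjoint_matrix U"
    by (rule hermitian_diagonalization)
  have a: "0 \<le> a i" for i
    using diagonal_gram(1)[OF gram_of_diagonalization[OF U H]] .
  have abs: "matrix_abs A = U ** real_diag (\<lambda>i. a i powr (1/2)) ** adjoint_matrix U"
    unfolding matrix_abs_def matrix_powr_def spectral_fun_diagonalized[OF U H] by (simp add: o_def)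
  have "matrix_powr (matrix_abs A) p = U ** real_diag (\<lambda>i. a i powr (p / 2)) ** adjoint_matrix U" for p
    unfolding matrix_powr_def spectral_fun_diagonalized[OF U abs] by (simp add: o_def powr_powr)
  moreover have "matrix_abs A = U ** real_diag (\<lambda>i. sqrt (a i)) ** adjoint_matrix U"
    using abs a by (simp add: powr_half_sqrt)
  ultimately show thesis
    using that U a H by blast
qed

lemma norm_mult_vec_sq:
  fixes A :: "complex^'n^'n"
  assumes "adjoint_matrix A ** A = U ** real_diag a ** adjoint_matrix U"
  shows "(norm (A *v x))\<^sup>2 = (\<Sum>i\<in>UNIV. a i * (cmod ((adjoint_matrix U *v x) $ i))\<^sup>2)"
proof -
  have "cinner (A *v x) (A *v x) = cinner x ((adjoint_matrix A ** A) *v x)"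
    by (simp add: matrix_vector_mul_assoc[symmetric] cinner_adjoint)
  then show ?thesis
    unfolding assms cinner_diagonalized by (simp only: cinner_self of_real_eq_iff)
qed

lemma sum_unitary_coords:
  assumes "unitary_matrix U"
  shows "(\<Sum>i\<in>UNIV. (cmod ((adjoint_matrix U *v x) $ i))\<^sup>2) = (norm x)\<^sup>2"
  by (metis norm_sq_eq_sum norm_adjoint_unitary assms)

lemma cinner_linear_combination:
  "cinner x ((r *\<^sub>R M + s *\<^sub>R N) *v x) =
    complex_of_real r * cinner x (M *v x) + complex_of_real s * cinner x (N *v x)"
proof -
  have "(r *\<^sub>R M + s *\<^sub>R N) *v x = r *\<^sub>R (M *v x) + s *\<^sub>R (N *v x)"
    by (simp add: vec_eq_iff matrix_vector_mult_def scaleR_sum_right sum.distrib distrib_right)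
  then show ?thesis
    by (simp add: cinner_add_right cinner_scaleR_right)
qed

section \<open>A lower bound for the quadratic form of the Young mean\<close>

definition young_mean :: "real \<Rightarrow> real \<Rightarrow> complex^'n^'n \<Rightarrow> complex^'n^'n \<Rightarrow> complex^'n^'n" where
  "young_mean p q A B = (1 / p) *\<^sub>R matrix_powr (matrix_abs A) p + (1 / q) *\<^sub>R matrix_powr (matrix_abs B) q"

lemma young_mean_commute: "young_mean p q A B = young_mean q p B A"
  by (simp add: young_mean_def add.commute)

text \<open>The exponent \<open>p / 2 \<ge> 1\<close> allows Jensen on the spectrum of
  \<open>A\<^sup>* A\<close>. For \<open>B\<close> the exponent \<open>q / 2\<close> may be below 1,
  so Jensen is applied to inverse eigenvalues with exponent \<open>- q / 2\<close>; this is possible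
  because \<open>x\<close> lies in the range of \<open>B\<^sup>*\<close>.\<close>

lemma young_quadratic_form_unit:
  fixes A B :: "complex^'n^'n"
  assumes pq: "p \<ge> 2" "q > 1" "1 / p + 1 / q = 1"
    and x: "x = adjoint_matrix B *v z" "norm x = 1"
    and t: "0 < t" "t * norm z \<le> norm (A *v x)"
  shows "t \<le> Re (cinner x (young_mean p q A B *v x))"
proof -
  obtain U a where U: "unitary_matrix U" and a: "\<And>i. 0 \<le> a i"
    and A: "adjoint_matrix A ** A = U ** real_diag a ** adjoint_matrix U"
    and P: "matrix_powr (matrix_abs A) p = U ** real_diag (\<lambda>i. a i powr (p / 2)) ** adjoint_matrix U"
    by (rule matrix_abs_diagonalization[of A]) blast
  obtain V b where V: "unitary_matrix V" and b: "\<And>i. 0 \<le> b i"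
    and B: "adjoint_matrix B ** B = V ** real_diag b ** adjoint_matrix V"
    and Q: "matrix_powr (matrix_abs B) q = V ** real_diag (\<lambda>i. b i powr (q / 2)) ** adjoint_matrix V"
    by (rule matrix_abs_diagonalization[of B]) blast
  define u where "u i = (cmod ((adjoint_matrix U *v x) $ i))\<^sup>2" for i
  define v where "v i = (cmod ((adjoint_matrix V *v x) $ i))\<^sup>2" for i
  have u: "sum u UNIV = 1" and v: "sum v UNIV = 1" and uv: "0 \<le> u i" "0 \<le> v i" for i
    using x(2) by (simp_all add: u_def v_def sum_unitary_coords U V)
  define N where "N = (\<Sum>i\<in>UNIV. u i * a i)"
  \<comment> \<open>This is the quadratic form at \<open>x\<close> of the pseudo-inverse of
    \<open>B\<^sup>* B\<close>. Since \<open>x = B\<^sup>* z\<close>, Bessel's inequality bounds it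
    by the squared norm of \<open>z\<close>, and \<open>x\<close> has no weight where
    \<open>b i = 0\<close>.\<close>
  define m where "m = (\<Sum>i\<in>UNIV. v i * inverse (b i))"
  have N: "N = (norm (A *v x))\<^sup>2"
    unfolding norm_mult_vec_sq[OF A] N_def u_def by (simp add: mult.commute)
  note gram = gram_of_diagonalization[OF V B]
  have Vx: "adjoint_matrix V *v x = (adjoint_matrix V ** adjoint_matrix B) *v z"
    by (simp add: x(1) matrix_vector_mul_assoc)
  have v0: "b i \<noteq> 0" if "v i \<noteq> 0" for i
    using diagonal_gram(2)[OF gram, of i z] that by (auto simp: v_def Vx)
  have mz: "m \<le> (norm z)\<^sup>2"
    using diagonal_gram(3)[OF gram, of z] by (simp add: m_def v_def Vx)
  have m0: "0 < m"
  proof -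
    obtain i where i: "v i \<noteq> 0"
      using v by (metis sum.neutral zero_neq_one)
    have "0 < v i * inverse (b i)"
      using i v0[OF i] uv(2)[of i] b[of i] by (simp add: order_less_le)
    then show ?thesis
      unfolding m_def using uv b by (intro sum_pos2[of _ i]) auto
  qed
  have "0 < norm z"
    using m0 mz by (metis less_le_trans zero_less_norm_iff zero_less_power2 norm_zero)
  then have N0: "0 < N"
    unfolding N using t by (metis less_le_trans mult_pos_pos zero_less_power)
  have "N powr (p / 2) \<le> (\<Sum>i\<in>UNIV. u i * a i powr (p / 2))"
    unfolding N_def using u uv a N0 pq by (intro powr_weighted_mean) (auto simp: N_def)
  moreover have "m powr (- q / 2) \<le> (\<Sum>i\<in>UNIV. v i * inverse (b i) powr (- q / 2))"
    unfolding m_def using v uv b m0 pq v0 by (intro powr_weighted_mean) (auto simp: m_def)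
  \<comment> \<open>At \<open>b i = 0\<close> both sides take the default value 0.\<close>
  moreover have "inverse (b i) powr (- q / 2) = b i powr (q / 2)" for i
    using b[of i] by (cases "b i = 0") (auto simp: powr_minus inverse_powr)
  moreover have "cinner x (young_mean p q A B *v x) =
      complex_of_real ((1 / p) * (\<Sum>i\<in>UNIV. u i * a i powr (p / 2)) + (1 / q) * (\<Sum>i\<in>UNIV. v i * b i powr (q / 2)))"
    unfolding young_mean_def cinner_linear_combination P Q cinner_diagonalized u_def v_def
    by (simp only: of_real_add of_real_mult mult.commute[of "_ powr _"])
  ultimately have "N powr (p / 2) / p + m powr (- q / 2) / q \<le> Re (cinner x (young_mean p q A B *v x))"
    using pq by (simp add: add_mono divide_right_mono)
  \<comment> \<open>Scalar Young for \<open>sqrt N\<close> and \<open>1 / sqrt m\<close>, whose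
    powers \<open>p\<close> and \<open>q\<close> are the two Jensen bounds.\<close>
  moreover have "sqrt N * (1 / sqrt m) \<le> N powr (p / 2) / p + m powr (- q / 2) / q"
  proof -
    have "sqrt N powr p = N powr (p / 2)" "(1 / sqrt m) powr q = m powr (- q / 2)"
      using powr_powr[of N "1/2" p] powr_powr[of m "- (1/2)" q] N0 m0
      by (simp_all add: powr_minus_divide powr_half_sqrt)
    then show ?thesis
      using Youngs_inequality[of p q "sqrt N" "1 / sqrt m"] pq N0 m0 by simp
  qed
  moreover have "t \<le> sqrt N * (1 / sqrt m)"
  proof -
    have "t * sqrt m \<le> t * norm z"
      using mz t by (intro mult_left_mono real_le_lsqrt) (auto intro: order.trans)
    also have "\<dots> \<le> sqrt N" using t(2) by (simp add: N)
    finally show ?thesis using m0 by (simp add: field_simps)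
  qed
  ultimately show ?thesis by linarith
qed

lemma young_quadratic_form:
  fixes A B :: "complex^'n^'n"
  assumes pq: "p \<ge> 2" "q > 1" "1 / p + 1 / q = 1"
    and x: "x = adjoint_matrix B *v z" "x \<noteq> 0"
    and t: "0 < t" "t * norm z \<le> norm (A *v x)"
  shows "t * (norm x)\<^sup>2 \<le> Re (cinner x (young_mean p q A B *v x))"
proof -
  define r where "r = inverse (norm x)"
  have r: "0 < r" "r * norm x = 1" using x(2) by (auto simp: r_def)
  have "t \<le> Re (cinner (r *\<^sub>R x) (young_mean p q A B *v (r *\<^sub>R x)))"
  proof (rule young_quadratic_form_unit[OF pq])
    show "r *\<^sub>R x = adjoint_matrix B *v (r *\<^sub>R z)"
      by (simp add: x(1) matrix_vector_mult_scaleR_right)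
    show "t * norm (r *\<^sub>R z) \<le> norm (A *v r *\<^sub>R x)"
      using t(2) r(1) by (simp add: matrix_vector_mult_scaleR_right mult.left_commute)
  qed (use r t in auto)
  also have "\<dots> = r\<^sup>2 * Re (cinner x (young_mean p q A B *v x))"
    by (simp add: matrix_vector_mult_scaleR_right inner_eq_Re_cinner[symmetric] power2_eq_square)
  finally have "t * (norm x)\<^sup>2 \<le> r\<^sup>2 * Re (cinner x (young_mean p q A B *v x)) * (norm x)\<^sup>2"
    by (rule mult_right_mono) simp
  also have "\<dots> = (r * norm x)\<^sup>2 * Re (cinner x (young_mean p q A B *v x))"
    by (simp add: power_mult_distrib)
  finally show ?thesis using r(2) by simp
qed

lemma cinner_axis: "cinner (axis i 1) x = x $ i"
proof -
  have "cnj ((axis i 1 :: complex^'a) $ j) * x $ j = (if j = i then x $ j else 0)" for j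
    by (simp add: axis_def)
  then show ?thesis by (simp add: cinner_def)
qed

text \<open>Ando's inequality \<open>s\<^sub>k(A B\<^sup>*) \<le> \<lambda>\<^sub>k(|A|\<^sup>p/p + |B|\<^sup>q/q)\<close>, stated without
  ordering the eigenvalues. On the span of the eigenvectors \<open>y\<close> with singular value at least
  \<open>t\<close>, the vectors \<open>B\<^sup>* y\<close> (if \<open>p \<ge> 2\<close>) or \<open>A\<^sup>* (A B\<^sup>* y)\<close> (if \<open>q \<ge> 2\<close>) have Rayleigh
  quotient at least \<open>t\<close>; a dimension count then compares the two spectra.\<close>
lemma ando_young_card:
  fixes A B :: "complex^'n^'n"
  assumes pq: "p > 1" "q > 1" "1 / p + 1 / q = 1"
    and U: "unitary_matrix U"
    and S: "adjoint_matrix (A ** adjoint_matrix B) ** (A ** adjoint_matrix B) = U ** real_diag \<sigma> ** adjoint_matrix U"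
    and V: "unitary_matrix V"
    and X: "young_mean p q A B = V ** real_diag e ** adjoint_matrix V"
    and t: "0 < t"
  shows "card {i. t \<le> sqrt (\<sigma> i)} \<le> card {j. t \<le> e j}"
proof (rule ccontr)
  let ?K = "{i. t \<le> sqrt (\<sigma> i)}" and ?J = "{j. t \<le> e j}"
  let ?M = "A ** adjoint_matrix B"
  assume "\<not> card ?K \<le> card ?J"
  then have lt: "card ?J < card ?K" by simp
  define T where "T = (if p \<ge> 2 then adjoint_matrix B else adjoint_matrix A ** ?M)"
  \<comment> \<open>Sends the coordinates of \<open>y\<close> in the eigenbasis \<open>U\<close> to
    those of \<open>T y\<close> in the eigenbasis \<open>V\<close> of the Young mean.\<close>
  define G where "G = adjoint_matrix V ** T ** U"
  \<comment> \<open>Orthogonality to \<open>W\<close> encodes the conditions that \<open>c\<close>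
    vanish outside \<open>?K\<close> and \<open>G *v c\<close> vanish on \<open>?J\<close>. If
    \<open>?K\<close> were larger than \<open>?J\<close>, these would be fewer than
    \<open>CARD('n)\<close> conditions, so a nonzero \<open>c\<close> meets them all.\<close>
  define W :: "(complex^'n) set" where
    "W = (\<lambda>i. axis i 1) ` (- ?K) \<union> (\<lambda>j. adjoint_matrix G *v axis j 1) ` ?J"
  have "card W \<le> card (- ?K) + card ?J"
    unfolding W_def by (meson add_mono card_Un_le card_image_le finite le_trans)
  also have "\<dots> < card (- ?K) + card ?K" using lt by simp
  also have "\<dots> = CARD('n)"
    by (metis Compl_partition2 Compl_disjoint2 card_Un_disjoint finite)
  finally have "card W < CARD('n)" .
  then obtain c where c0: "c \<noteq> 0" and c: "\<And>u. u \<in> W \<Longrightarrow> cinner u c = 0"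
    by (rule exists_cinner_orthogonal[rotated]) (auto simp: W_def)
  have cK: "c $ i = 0" if "\<not> t \<le> sqrt (\<sigma> i)" for i
    using c[of "axis i 1"] that by (simp add: W_def cinner_axis)
  have cJ: "(G *v c) $ j = 0" if "t \<le> e j" for j
    using c[of "adjoint_matrix G *v axis j 1"] that
    by (simp add: W_def cinner_axis cinner_adjoint[symmetric])
  define y where "y = U *v c"
  define x where "x = T *v y"
  have Uy: "adjoint_matrix U *v y = c"
    using U by (simp add: y_def matrix_vector_mul_assoc unitary_matrix_def)
  have Gc: "G *v c = adjoint_matrix V *v x"
    by (simp add: G_def x_def y_def matrix_vector_mul_assoc matrix_mul_assoc)
  have y0: "0 < norm y"
    using norm_adjoint_unitary[OF U, of y] c0 by (metis Uy zero_less_norm_iff)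
  have My: "(norm (?M *v y))\<^sup>2 = (\<Sum>i\<in>UNIV. \<sigma> i * (cmod (c $ i))\<^sup>2)"
    unfolding norm_mult_vec_sq[OF S] Uy ..
  have sq: "t\<^sup>2 * (cmod (c $ i))\<^sup>2 \<le> \<sigma> i * (cmod (c $ i))\<^sup>2" for i
  proof (cases "c $ i = 0")
    case False
    then have "t \<le> sqrt (\<sigma> i)" using cK by blast
    \<comment> \<open>\<open>sqrt\<close> of a negative real is negative, so a positive lower bound
      on it makes \<open>\<sigma> i\<close> positive, which allows squaring.\<close>
    then have "t\<^sup>2 \<le> \<sigma> i"
      using t by (metis less_le_trans not_less order_less_imp_le power_mono real_sqrt_gt_0_iff real_sqrt_pow2)
    then show ?thesis by (rule mult_right_mono) simp
  qed simp
  have "(t * norm y)\<^sup>2 \<le> (norm (?M *v y))\<^sup>2"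
    unfolding My power_mult_distrib sum_unitary_coords[OF U, of y, symmetric] Uy sum_distrib_left
    by (rule sum_mono) (rule sq)
  then have tMy: "t * norm y \<le> norm (?M *v y)"
    by (rule power2_le_imp_le) simp
  then have My0: "0 < norm (?M *v y)"
    using t y0 by (metis less_le_trans mult_pos_pos)
  have "t * (norm x)\<^sup>2 \<le> Re (cinner x (young_mean p q A B *v x)) \<and> x \<noteq> 0"
  proof (cases "p \<ge> 2")
    case True
    then have xB: "x = adjoint_matrix B *v y" and Ax: "A *v x = ?M *v y"
      by (simp_all add: x_def T_def matrix_vector_mul_assoc)
    have "x \<noteq> 0" using Ax My0 by auto
    then show ?thesis
      using young_quadratic_form[OF True pq(2,3) xB] t tMy Ax by simp
  next
    case False
    have "q \<ge> 2"
    proof (rule ccontr)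
      assume "\<not> q \<ge> 2"
      then have "1 / p > 1 / 2" "1 / q > 1 / 2" using False pq by (auto simp: field_simps)
      then show False using pq(3) by linarith
    qed
    \<comment> \<open>Here \<open>A\<close> and \<open>B\<close> exchange roles, with
      \<open>?M *v y\<close> in place of \<open>y\<close>. Then \<open>B x\<close> is the Gram
      matrix of \<open>?M\<close> applied to \<open>y\<close>, so in the basis \<open>U\<close> it
      only rescales coordinates by \<open>\<sigma>\<close>, and the needed norm bound follows
      coordinatewise.\<close>
    have xA: "x = adjoint_matrix A *v (?M *v y)"
      using False by (simp add: x_def T_def matrix_vector_mul_assoc)
    have "B *v x = adjoint_matrix ?M *v (?M *v y)"
      by (simp add: xA adjoint_matrix_mul matrix_vector_mul_assoc matrix_mul_assoc)
    also have "\<dots> = U *v (real_diag \<sigma> *v c)"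
      unfolding matrix_vector_mul_assoc S Uy[symmetric] by (simp add: matrix_mul_assoc)
    finally have Bx: "adjoint_matrix U *v (B *v x) = real_diag \<sigma> *v c"
      using U by (simp add: matrix_vector_mul_assoc matrix_mul_assoc unitary_matrix_def)
    have "(t * norm (?M *v y))\<^sup>2 \<le> (norm (B *v x))\<^sup>2"
      unfolding My power_mult_distrib sum_unitary_coords[OF U, of "B *v x", symmetric] Bx sum_distrib_left
    proof (rule sum_mono)
      fix i
      show "t\<^sup>2 * (\<sigma> i * (cmod (c $ i))\<^sup>2) \<le> (cmod ((real_diag \<sigma> *v c) $ i))\<^sup>2"
      proof (cases "c $ i = 0")
        case False
        then have "0 \<le> \<sigma> i"
          using cK[of i] t by (meson dual_order.trans less_imp_le real_sqrt_ge_0_iff)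
        from mult_left_mono[OF sq[of i] this] show ?thesis
          unfolding real_diag_mult_vec_nth
          by (simp add: norm_mult power_mult_distrib mult_ac power2_eq_square)
      qed simp
    qed
    then have tBx: "t * norm (?M *v y) \<le> norm (B *v x)"
      by (rule power2_le_imp_le) simp
    then have "x \<noteq> 0"
      using My0 t by (metis less_le_trans mult_pos_pos matrix_vector_mult_0_right norm_zero less_irrefl)
    then show ?thesis
      using young_quadratic_form[OF \<open>q \<ge> 2\<close> pq(1) _ xA _ t tBx] pq(3)
      by (simp add: young_mean_commute add.commute)
  qed
  then have ge: "t * (norm x)\<^sup>2 \<le> (\<Sum>j\<in>UNIV. e j * (cmod ((G *v c) $ j))\<^sup>2)" and x0: "x \<noteq> 0"
    unfolding X cinner_diagonalized Gc by simp_all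
  \<comment> \<open>All coordinates of \<open>x\<close> sit at eigenvalues below \<open>t\<close>,
    so its Rayleigh quotient is strictly less than \<open>t\<close>, contradicting
    \<open>ge\<close>.\<close>
  have le: "e j * (cmod ((G *v c) $ j))\<^sup>2 \<le> t * (cmod ((G *v c) $ j))\<^sup>2" for j
    using cJ[of j] by (cases "t \<le> e j") (auto intro: mult_right_mono)
  have norm_x: "(norm x)\<^sup>2 = (\<Sum>j\<in>UNIV. (cmod ((G *v c) $ j))\<^sup>2)"
    unfolding Gc sum_unitary_coords[OF V] ..
  obtain j where j: "(G *v c) $ j \<noteq> 0"
    using norm_x x0 by force
  then have "e j < t" using cJ by force
  then have "e j * (cmod ((G *v c) $ j))\<^sup>2 < t * (cmod ((G *v c) $ j))\<^sup>2"
    using j by (intro mult_strict_right_mono) auto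
  then have "(\<Sum>j\<in>UNIV. e j * (cmod ((G *v c) $ j))\<^sup>2) < (\<Sum>j\<in>UNIV. t * (cmod ((G *v c) $ j))\<^sup>2)"
    using le by (intro sum_strict_mono_ex1) auto
  also have "\<dots> = t * (norm x)\<^sup>2" by (simp add: norm_x sum_distrib_left)
  finally show False using ge by simp
qed

section \<open>Doubly stochastic averages of eigenvalues\<close>

lemma sum_unitary_row:
  assumes "unitary_matrix W"
  shows "(\<Sum>j\<in>UNIV. (cmod (W $ i $ j))\<^sup>2) = 1"
proof -
  have "complex_of_real (\<Sum>j\<in>UNIV. (cmod (W $ i $ j))\<^sup>2) = (W ** adjoint_matrix W) $ i $ i"
    by (simp add: matrix_matrix_mult_def complex_norm_square del: of_real_power)
  also have "\<dots> = 1" using assms by (simp add: unitary_matrix_def mat_def)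
  finally show ?thesis by (simp only: of_real_eq_1_iff)
qed

lemma sum_unitary_column:
  assumes "unitary_matrix W"
  shows "(\<Sum>i\<in>UNIV. (cmod (W $ i $ j))\<^sup>2) = 1"
  using sum_unitary_row[OF unitary_matrix_adjoint[OF assms], of j] by simp

text \<open>The squared moduli of the entries of a unitary matrix are doubly stochastic.\<close>
lemma sum_power_unitary_average:
  assumes W: "unitary_matrix W" and a: "\<And>j. 0 \<le> a j"
  shows "(\<Sum>i\<in>UNIV. (\<Sum>j\<in>UNIV. (cmod (W $ j $ i))\<^sup>2 * a j) ^ k) \<le> (\<Sum>j\<in>UNIV. a j ^ k)"
proof -
  have "(\<Sum>i\<in>UNIV. (\<Sum>j\<in>UNIV. (cmod (W $ j $ i))\<^sup>2 * a j) ^ k)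
      \<le> (\<Sum>i\<in>UNIV. \<Sum>j\<in>UNIV. (cmod (W $ j $ i))\<^sup>2 * a j ^ k)"
    using a by (intro sum_mono power_weighted_mean sum_unitary_column[OF W]) auto
  also have "\<dots> = (\<Sum>j\<in>UNIV. (\<Sum>i\<in>UNIV. (cmod (W $ j $ i))\<^sup>2) * a j ^ k)"
    by (subst sum.swap) (simp add: sum_distrib_right)
  finally show ?thesis by (simp add: sum_unitary_row[OF W])
qed


section \<open>Traces of power series\<close>

lemma trace_matrix_series_abs_coeffs:
  assumes U: "unitary_matrix U" and sm: "\<And>i. summable (\<lambda>k. cmod (\<alpha> k) * d i ^ k)"
  shows "trace (matrix_series (abs_coeffs \<alpha>) (U ** real_diag d ** adjoint_matrix U)) =
    complex_of_real (\<Sum>k. cmod (\<alpha> k) * (\<Sum>i\<in>UNIV. d i ^ k))"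
proof -
  have "summable (\<lambda>k. abs_coeffs \<alpha> k * complex_of_real (d i) ^ k)" for i
    using summable_of_real[OF sm[of i]] by (simp add: abs_coeffs_def)
  from matrix_series_diagonalized[OF U, of "abs_coeffs \<alpha>" d, OF this]
  have "(\<lambda>k. complex_of_real (cmod (\<alpha> k) * (\<Sum>i\<in>UNIV. d i ^ k))) sums
      trace (matrix_series (abs_coeffs \<alpha>) (U ** real_diag d ** adjoint_matrix U))"
    by (simp only: abs_coeffs_def of_real_mult)
  moreover have "summable (\<lambda>k. cmod (\<alpha> k) * (\<Sum>i\<in>UNIV. d i ^ k))"
    unfolding sum_distrib_left by (intro summable_sum sm)
  ultimately show ?thesis
    by (metis sums_of_real sums_unique2 summable_sums)
qed

lemma norm_trace_matrix_series_le:
  assumes U: "unitary_matrix U" and d: "\<And>i. 0 \<le> d i"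
    and sm: "\<And>i. summable (\<lambda>k. cmod (\<alpha> k) * d i ^ k)"
  shows "cmod (trace (matrix_series \<alpha> (U ** real_diag d ** adjoint_matrix U))) \<le>
    (\<Sum>k. cmod (\<alpha> k) * (\<Sum>i\<in>UNIV. d i ^ k))"
proof -
  have "summable (\<lambda>k. \<alpha> k * complex_of_real (d i) ^ k)" for i
    using sm[of i] d[of i] by - (rule summable_norm_cancel, simp add: norm_mult norm_power)
  from matrix_series_diagonalized[OF U, of \<alpha> d, OF this]
  have "trace (matrix_series \<alpha> (U ** real_diag d ** adjoint_matrix U)) =
      (\<Sum>k. \<alpha> k * complex_of_real (\<Sum>i\<in>UNIV. d i ^ k))"
    by (rule sums_unique)
  moreover have norm: "norm (\<alpha> k * complex_of_real (\<Sum>i\<in>UNIV. d i ^ k)) = cmod (\<alpha> k) * (\<Sum>i\<in>UNIV. d i ^ k)" for k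
    using d by (simp add: norm_mult sum_nonneg del: of_real_sum)
  moreover have "summable (\<lambda>k. cmod (\<alpha> k) * (\<Sum>i\<in>UNIV. d i ^ k))"
    unfolding sum_distrib_left by (intro summable_sum sm)
  ultimately show ?thesis
    using summable_norm[of "\<lambda>k. \<alpha> k * complex_of_real (\<Sum>i\<in>UNIV. d i ^ k)"] by (simp only: norm)
qed

lemma summable_norm_coeffs:
  fixes \<alpha> :: "nat \<Rightarrow> complex"
  assumes conv: "\<And>z :: complex. ereal (cmod z) < R \<Longrightarrow> summable (\<lambda>k. \<alpha> k * z ^ k)"
    and r: "0 \<le> r" "ereal r < R"
  shows "summable (\<lambda>k. cmod (\<alpha> k) * r ^ k)"
proof -
  \<comment> \<open>Absolute convergence at \<open>r\<close> follows from convergence at a larger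
    radius; a real \<open>s\<close> below \<open>R\<close> exists also for infinite
    \<open>R\<close>.\<close>
  obtain s where s: "r < s" "ereal s < R"
    using ereal_dense3[OF r(2)] ereal_dense2[OF r(2)] by auto
  have "summable (\<lambda>k. norm (\<alpha> k * complex_of_real r ^ k))"
    using conv[of "complex_of_real s"] s r by (intro powser_insidea[where x = "complex_of_real s"]) auto
  then show ?thesis
    using r(1) by (simp add: norm_mult norm_power)
qed


theorem proposition6:
  fixes \<alpha> :: "nat \<Rightarrow> complex" and R :: ereal and p q :: real
    and A B :: "complex^'n^'n"
  assumes "R > 0"
    and "\<And>z :: complex. ereal (cmod z) < R \<Longrightarrow> summable (\<lambda>k. \<alpha> k * z ^ k)"
    and "p > 1" and "q > 1" and "1 / p + 1 / q = 1"
    and "ereal (Re (trace (matrix_powr (matrix_abs A) p))) < R"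
    and "ereal (Re (trace (matrix_powr (matrix_abs B) q))) < R"
  shows "complex_of_real
           (cmod (trace (matrix_series \<alpha> (matrix_abs (A ** adjoint_matrix B)))))
         \<le> trace (matrix_series (abs_coeffs \<alpha>)
             ((1 / p) *\<^sub>R matrix_powr (matrix_abs A) p
              + (1 / q) *\<^sub>R matrix_powr (matrix_abs B) q))
       \<and> trace (matrix_series (abs_coeffs \<alpha>)
             ((1 / p) *\<^sub>R matrix_powr (matrix_abs A) p
              + (1 / q) *\<^sub>R matrix_powr (matrix_abs B) q))
         \<le> trace ((1 / p) *\<^sub>R matrix_series (abs_coeffs \<alpha>) (matrix_powr (matrix_abs A) p)
              + (1 / q) *\<^sub>R matrix_series (abs_coeffs \<alpha>) (matrix_powr (matrix_abs B) q))"
proof -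

  \<comment> \<open>Spectral data of the matrices involved\<close>
  note pq = assms(3-5)
  obtain U a0 where U: "unitary_matrix U"
    and P0: "\<And>p. matrix_powr (matrix_abs A) p = U ** real_diag (\<lambda>i. a0 i powr (p / 2)) ** adjoint_matrix U"
    by (rule matrix_abs_diagonalization[of A]) blast
  obtain V b0 where V: "unitary_matrix V"
    and Q0: "\<And>p. matrix_powr (matrix_abs B) p = V ** real_diag (\<lambda>i. b0 i powr (p / 2)) ** adjoint_matrix V"
    by (rule matrix_abs_diagonalization[of B]) blast
  define a where "a i = a0 i powr (p / 2)" for i
  define b where "b i = b0 i powr (q / 2)" for i
  have P: "matrix_powr (matrix_abs A) p = U ** real_diag a ** adjoint_matrix U"
    and Q: "matrix_powr (matrix_abs B) q = V ** real_diag b ** adjoint_matrix V"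
    unfolding P0 Q0 a_def b_def by simp_all
  have a: "0 \<le> a i" and b: "0 \<le> b i" for i by (simp_all add: a_def b_def)
  obtain S \<sigma> where S: "unitary_matrix S" and \<sigma>: "\<And>i. 0 \<le> \<sigma> i"
    and M: "adjoint_matrix (A ** adjoint_matrix B) ** (A ** adjoint_matrix B) = S ** real_diag \<sigma> ** adjoint_matrix S"
    and absM: "matrix_abs (A ** adjoint_matrix B) = S ** real_diag (\<lambda>i. sqrt (\<sigma> i)) ** adjoint_matrix S"
    by (rule matrix_abs_diagonalization[of "A ** adjoint_matrix B"]) blast
  let ?X = "young_mean p q A B"
  have "adjoint_matrix ?X = ?X"
    by (simp add: young_mean_def P Q adjoint_matrix_add adjoint_matrix_scaleR adjoint_matrix_mul matrix_mul_assoc)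
  then obtain W e where W: "unitary_matrix W" and X: "?X = W ** real_diag e ** adjoint_matrix W"
    by (rule hermitian_diagonalization)

  \<comment> \<open>Base changes from the eigenbasis of \<open>?X\<close> to those of the two
    powers. The squared moduli in column \<open>i\<close> are the weights in the Rayleigh quotients
    at the \<open>i\<close>-th eigenvector of \<open>?X\<close>, which yields the formula for
    \<open>e i\<close>.\<close>
  define F where "F = adjoint_matrix U ** W"
  define G where "G = adjoint_matrix V ** W"
  have F: "unitary_matrix F" and G: "unitary_matrix G"
    unfolding F_def G_def by (intro unitary_matrix_mul unitary_matrix_adjoint U V W)+
  have e: "e i = (1 / p) * (\<Sum>j\<in>UNIV. (cmod (F $ j $ i))\<^sup>2 * a j) + (1 / q) * (\<Sum>j\<in>UNIV. (cmod (G $ j $ i))\<^sup>2 * b j)" for i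
  proof -
    let ?w = "W *v axis i 1"
    have col: "(N *v axis i 1) $ j = N $ j $ i" for N :: "complex^'n^'n" and j
      by (simp add: matrix_vector_mult_def axis_def if_distrib cong: if_cong)
    have "adjoint_matrix W *v ?w = axis i 1"
      using W by (simp add: matrix_vector_mul_assoc unitary_matrix_def)
    then have "cinner ?w (?X *v ?w) = complex_of_real (\<Sum>j\<in>UNIV. e j * (cmod (axis i 1 $ j))\<^sup>2)"
      unfolding X cinner_diagonalized by simp
    also have "(\<Sum>j\<in>UNIV. e j * (cmod (axis i 1 $ j))\<^sup>2) = (\<Sum>j\<in>UNIV. if j = i then e j else 0)"
      by (intro sum.cong) (auto simp: axis_def)
    finally have 1: "cinner ?w (?X *v ?w) = complex_of_real (e i)" by simp
    have UF: "adjoint_matrix U *v ?w = F *v axis i 1" and VG: "adjoint_matrix V *v ?w = G *v axis i 1"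
      by (simp_all add: F_def G_def matrix_vector_mul_assoc)
    have "cinner ?w (?X *v ?w) = complex_of_real ((1 / p) * (\<Sum>j\<in>UNIV. (cmod (F $ j $ i))\<^sup>2 * a j)
        + (1 / q) * (\<Sum>j\<in>UNIV. (cmod (G $ j $ i))\<^sup>2 * b j))"
      unfolding young_mean_def cinner_linear_combination P Q cinner_diagonalized UF VG col
      by (simp only: of_real_add of_real_mult mult.commute[of "a _"] mult.commute[of "b _"])
    with 1 show ?thesis by (simp only: of_real_eq_iff)
  qed
  have e0: "0 \<le> e i" for i
    unfolding e using a b pq by (intro add_nonneg_nonneg mult_nonneg_nonneg sum_nonneg) auto

  have tr: "sum e UNIV = (1 / p) * sum a UNIV + (1 / q) * sum b UNIV"
  proof -
    have "trace ?X = complex_of_real (1 / p) * trace (U ** real_diag a ** adjoint_matrix U)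
        + complex_of_real (1 / q) * trace (V ** real_diag b ** adjoint_matrix V)"
      by (simp add: young_mean_def P Q trace_def sum.distrib sum_distrib_left scaleR_conv_of_real[where 'a=complex])
    then have "complex_of_real (sum e UNIV) = complex_of_real ((1 / p) * sum a UNIV + (1 / q) * sum b UNIV)"
      unfolding X trace_diagonalized[OF U] trace_diagonalized[OF V] trace_diagonalized[OF W]
      by (simp only: of_real_add of_real_mult)
    then show ?thesis by (simp only: of_real_eq_iff)
  qed
  have aR: "ereal (sum a UNIV) < R" and bR: "ereal (sum b UNIV) < R"
    using assms(6,7) unfolding P Q trace_diagonalized[OF U] trace_diagonalized[OF V] by simp_all
  \<comment> \<open>The trace of \<open>?X\<close> is a convex combination of two traces below
    \<open>R\<close>.\<close>
  have eR: "ereal (sum e UNIV) < R"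
  proof -
    have "sum e UNIV \<le> max (sum a UNIV) (sum b UNIV)"
      unfolding tr using pq by (intro convex_bound_le) auto
    then have "ereal (sum e UNIV) \<le> max (ereal (sum a UNIV)) (ereal (sum b UNIV))"
      by (simp add: ereal_max[symmetric] del: ereal_max)
    also have "\<dots> < R" using aR bR by simp
    finally show ?thesis .
  qed
  have sum_power_sqrt: "(\<Sum>i\<in>UNIV. sqrt (\<sigma> i) ^ k) \<le> (\<Sum>i\<in>UNIV. e i ^ k)" for k
  proof (rule sum_power_le_of_card_superlevel)
    show "card {i \<in> UNIV. t \<le> sqrt (\<sigma> i)} \<le> card {j \<in> UNIV. t \<le> e j}" for t
    proof (cases "0 < t")
      case True
      then show ?thesis using ando_young_card[OF pq S M W X] by simp
    next
      case False
      then have "{j. t \<le> e j} = UNIV" using e0 by (auto intro: order.trans[of t 0])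
      then show ?thesis by (simp add: card_mono)
    qed
  qed (use \<sigma> in auto)
  \<comment> \<open>The case of exponent 1 transfers the trace bound to the singular values of the
    product. As all eigenvalues are nonnegative, each is at most its trace and lies inside the disk
    of convergence.\<close>
  have sR: "ereal (\<Sum>i\<in>UNIV. sqrt (\<sigma> i)) < R"
    using sum_power_sqrt[of 1] by (intro le_less_trans[OF _ eR]) simp

  have summ: "summable (\<lambda>k. cmod (\<alpha> k) * d i ^ k)"
    if d: "\<And>i. 0 \<le> d i" "ereal (sum d UNIV) < R" for d :: "'n \<Rightarrow> real" and i
  proof (rule summable_norm_coeffs[OF assms(2)])
    have "d i \<le> sum d UNIV" using d(1) by (intro member_le_sum) auto
    then show "ereal (d i) < R" using d(2) by (meson ereal_less_eq(3) le_less_trans)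
  qed (use d in auto)
  note sm = summ[OF _ sR] summ[OF e0 eR] summ[OF a aR] summ[OF b bR]
  have sm_sum: "summable (\<lambda>k. cmod (\<alpha> k) * (\<Sum>i\<in>UNIV. d i ^ k))"
    if "\<And>i. summable (\<lambda>k. cmod (\<alpha> k) * d i ^ k)" for d :: "'n \<Rightarrow> real"
    unfolding sum_distrib_left by (intro summable_sum that)
  let ?T = "\<lambda>d :: 'n \<Rightarrow> real. \<Sum>k. cmod (\<alpha> k) * (\<Sum>i\<in>UNIV. d i ^ k)"

  \<comment> \<open>The first inequality: termwise comparison of power sums\<close>
  have "cmod (trace (matrix_series \<alpha> (matrix_abs (A ** adjoint_matrix B)))) \<le> ?T (\<lambda>i. sqrt (\<sigma> i))"
    unfolding absM using \<sigma> by (intro norm_trace_matrix_series_le S sm) auto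
  also have "\<dots> \<le> ?T e"
    using \<sigma> by (intro suminf_le mult_left_mono sum_power_sqrt sm_sum sm) auto
  finally have first: "cmod (trace (matrix_series \<alpha> (matrix_abs (A ** adjoint_matrix B)))) \<le> ?T e" .

  \<comment> \<open>The second inequality: convexity of powers\<close>
  have "(\<Sum>i\<in>UNIV. e i ^ k) \<le> (1 / p) * (\<Sum>i\<in>UNIV. a i ^ k) + (1 / q) * (\<Sum>i\<in>UNIV. b i ^ k)" for k
  proof -
    let ?f = "\<lambda>i. \<Sum>j\<in>UNIV. (cmod (F $ j $ i))\<^sup>2 * a j" and ?g = "\<lambda>i. \<Sum>j\<in>UNIV. (cmod (G $ j $ i))\<^sup>2 * b j"
    \<comment> \<open>Jensen on a two-point space, indexed by \<open>bool\<close> with weights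
      \<open>1 / p\<close> and \<open>1 / q\<close>; averaging over the unitary weights comes
      afterwards.\<close>
    have "e i ^ k \<le> (1 / p) * ?f i ^ k + (1 / q) * ?g i ^ k" for i
      using power_weighted_mean[of "UNIV :: bool set" "\<lambda>c. if c then 1 / p else 1 / q"
          "\<lambda>c. if c then ?f i else ?g i" k] pq a b
      by (simp add: UNIV_bool e sum_nonneg add.commute)
    then have "(\<Sum>i\<in>UNIV. e i ^ k) \<le> (1 / p) * (\<Sum>i\<in>UNIV. ?f i ^ k) + (1 / q) * (\<Sum>i\<in>UNIV. ?g i ^ k)"
      unfolding sum_distrib_left sum.distrib[symmetric] by (rule sum_mono)
    also have "\<dots> \<le> (1 / p) * (\<Sum>i\<in>UNIV. a i ^ k) + (1 / q) * (\<Sum>i\<in>UNIV. b i ^ k)"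
      using pq by (intro add_mono mult_left_mono sum_power_unitary_average F G a b) auto
    finally show ?thesis .
  qed
  then have "?T e \<le> (\<Sum>k. cmod (\<alpha> k) * ((1 / p) * (\<Sum>i\<in>UNIV. a i ^ k) + (1 / q) * (\<Sum>i\<in>UNIV. b i ^ k)))"
    by (intro suminf_le mult_left_mono sm_sum sm)
      (auto intro!: summable_add summable_mult sm_sum sm simp: distrib_left mult.left_commute[of "cmod _"] simp del: times_divide_eq_left)
  also have "\<dots> = (1 / p) * ?T a + (1 / q) * ?T b"
    unfolding distrib_left mult.left_commute[of "cmod _"]
    by (simp only: suminf_add[symmetric] suminf_mult summable_mult sm_sum sm)
  finally have second: "?T e \<le> (1 / p) * ?T a + (1 / q) * ?T b" .

  have "trace ((1 / p) *\<^sub>R N + (1 / q) *\<^sub>R N') = complex_of_real (1 / p) * trace N + complex_of_real (1 / q) * trace N'"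
    for N N' :: "complex^'n^'n"
    by (simp add: trace_def sum.distrib sum_distrib_left scaleR_conv_of_real[where 'a=complex])
  then have rhs: "trace ((1 / p) *\<^sub>R matrix_series (abs_coeffs \<alpha>) (matrix_powr (matrix_abs A) p)
      + (1 / q) *\<^sub>R matrix_series (abs_coeffs \<alpha>) (matrix_powr (matrix_abs B) q)) =
      complex_of_real ((1 / p) * ?T a + (1 / q) * ?T b)"
    by (simp only: P Q trace_matrix_series_abs_coeffs[OF U sm(3)] trace_matrix_series_abs_coeffs[OF V sm(4)]
        of_real_add of_real_mult)
  show ?thesis
    \<comment> \<open>The order on complex numbers also demands equal imaginary parts. Every term is
      now an embedded real, so only the two real inequalities remain.\<close>
    unfolding young_mean_def[symmetric] rhs unfolding X trace_matrix_series_abs_coeffs[OF W sm(2)]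
    using first second by (simp only: less_eq_complex_def Re_complex_of_real Im_complex_of_real simp_thms)
qed

end
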